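(* Let $P=(V,\leq)$ be a finite ordered set that has a good pair. Then $P$ has a balanced pair, i.e. there exist $x,y\in V$ with $\frac13\leq \mathbb{P}(x\prec y)\leq \frac23$.
   Context: For a finite ordered set $P=(V,\leq)$, a linear extension is a total order on $V$ extending $\leq$; $\mathbb{P}(x\prec y)$ (or $\mathbb{P}_P(x\prec y)$) denotes the proportion of linear extensions of $P$ that put $x$ before $y$. A pair $(x,y)$ is balanced if $1/3\leq \mathbb{P}(x\prec y)\leq 2/3$. For $u\in V$, $D(u)=\{v\in V: v<u\}$ and $U(u)=\{v\in V: u<v\}$. The dual $P^*$ of $P$ is the order on $V$ with $x\leq y$ in $P^*$ iff $y\leq x$ in $P$. A pair $(a,b)$ of elements of $V$ is good if the following two conditions hold simultaneously in $P$, or hold simultaneously in $P^*$ (with $D$, $U$ and $\mathbb{P}$ computed in that ordered set): (i) $D(a)\subseteq D(b)$ and $U(b)\setminus U(a)$ is a chain (possibly empty); and (ii) $\mathbb{P}(a\prec b)\leq \frac12$. *)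

theory Defs
  imports Complex_Main
begin

text \<open>
  A finite ordered set is a finite carrier \<open>V\<close> with a reflexive order relation \<open>r\<close> satisfying
  \<^const>\<open>partial_order_on\<close>, where \<open>(x, y) \<in> r\<close> reads \<open>x \<le> y\<close>. Its dual is \<open>r\<inverse>\<close>, and the strict
  down-set \<open>D(u)\<close> and up-set \<open>U(u)\<close> are \<open>underS r u\<close> and \<open>aboveS r u\<close>.
\<close>

definition linear_extensions :: "'a set \<Rightarrow> 'a rel \<Rightarrow> 'a rel set" where
  "linear_extensions V r = {L. linear_order_on V L \<and> r \<subseteq> L}"

text \<open>"Before" is strict, so \<open>prob_before V r x x = 0\<close>.\<close>

definition prob_before :: "'a set \<Rightarrow> 'a rel \<Rightarrow> 'a \<Rightarrow> 'a \<Rightarrow> real" where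
  "prob_before V r x y =
     real (card {L \<in> linear_extensions V r. x \<noteq> y \<and> (x, y) \<in> L})
       / real (card (linear_extensions V r))"

definition balanced_pair :: "'a set \<Rightarrow> 'a rel \<Rightarrow> 'a \<Rightarrow> 'a \<Rightarrow> bool" where
  "balanced_pair V r x y \<longleftrightarrow>
     x \<in> V \<and> y \<in> V \<and> 1/3 \<le> prob_before V r x y \<and> prob_before V r x y \<le> 2/3"

definition good_conditions :: "'a set \<Rightarrow> 'a rel \<Rightarrow> 'a \<Rightarrow> 'a \<Rightarrow> bool" where
  "good_conditions V r a b \<longleftrightarrow>
     underS r a \<subseteq> underS r b \<and> aboveS r b - aboveS r a \<in> Chains r \<and>
     prob_before V r a b \<le> 1/2"

text \<open>
  The two elements of a good pair are distinct: otherwise \<open>(a, a)\<close> would satisfy both conditions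
  in every ordered set, since \<open>prob_before V r a a = 0\<close>.
\<close>

definition good_pair :: "'a set \<Rightarrow> 'a rel \<Rightarrow> 'a \<Rightarrow> 'a \<Rightarrow> bool" where
  "good_pair V r a b \<longleftrightarrow>
     a \<in> V \<and> b \<in> V \<and> a \<noteq> b \<and>
     (good_conditions V r a b \<or> good_conditions V (r\<inverse>) a b)"

end

theory Submission
  imports Defs "HOL-Combinatorics.Transposition"
begin

text \<open>
  Suppose the good pair satisfies the conditions in \<open>P\<close> itself, and let
  \<open>C = {b} \<union> (U(b) - U(a))\<close>, a finite chain with least element \<open>b\<close>. If \<open>(a, b)\<close> is not balanced, then
  \<open>P(a \<prec> b) < 1/3\<close>, so there is a greatest \<open>c \<in> C\<close> with \<open>P(a \<prec> c) < 1/3\<close>. Exchanging \<open>a\<close> and \<open>c\<close>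
  maps the linear extensions in which \<open>a\<close> comes after \<open>c\<close> but before all later elements of \<open>C\<close>
  injectively to linear extensions with \<open>a \<prec> c\<close>. If \<open>c\<close> has a successor \<open>e\<close> in \<open>C\<close>, this gives
  \<open>1/3 \<le> P(a \<prec> e) \<le> 2 P(a \<prec> c) < 2/3\<close>; otherwise it gives \<open>1 \<le> 2 P(a \<prec> c) < 2/3\<close>, which is absurd.
\<close>

section \<open>Extrema of finite chains\<close>

lemma finite_chain_greatest:
  assumes "finite A" "A \<noteq> {}" "A \<in> Chains r" "trans r"
  shows "\<exists>m\<in>A. \<forall>x\<in>A. (x, m) \<in> r"
  using assms(1-3)
proof (induction rule: finite_ne_induct)
  case (singleton x)
  then show ?case by (auto simp: Chains_def)
next
  case (insert x F)
  then obtain m where m: "m \<in> F" "\<forall>y\<in>F. (y, m) \<in> r" by (auto simp: Chains_def)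
  have x: "(x, x) \<in> r" and "(x, m) \<in> r \<or> (m, x) \<in> r"
    using insert.prems m(1) by (auto simp: Chains_def)
  then show ?case
  proof (elim disjE)
    assume "(m, x) \<in> r"
    then show ?thesis using m x \<open>trans r\<close> by (blast dest: transD)
  qed (use m in blast)
qed

lemma finite_chain_least:
  assumes "finite A" "A \<noteq> {}" "A \<in> Chains r" "trans r"
  shows "\<exists>m\<in>A. \<forall>x\<in>A. (m, x) \<in> r"
  using finite_chain_greatest[of A "r\<inverse>"] assms by (auto simp: Chains_def)

section \<open>Existence, finiteness and duality of linear extensions\<close>

lemma finite_partial_order_maximal:
  assumes "finite V" "V \<noteq> {}" "partial_order_on V r"
  shows "\<exists>m\<in>V. \<forall>x\<in>V. (m, x) \<in> r \<longrightarrow> x = m"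
proof -
  \<comment> \<open>\<open>bex_max_element\<close> wants an asymmetric relation, so the strict part
    of \<open>r\<close> is used.\<close>
  have "\<exists>m\<in>V. \<forall>x\<in>V. x \<noteq> m \<longrightarrow> \<not> ((m, x) \<in> r \<and> m \<noteq> x)"
  proof (rule Finite_Set.bex_max_element)
    show "asymp_on V (\<lambda>m x. (m, x) \<in> r \<and> m \<noteq> x)"
      using assms(3) unfolding order_on_defs asymp_on_def by (meson antisymD)
    show "transp_on V (\<lambda>m x. (m, x) \<in> r \<and> m \<noteq> x)"
      using assms(3) unfolding order_on_defs transp_on_def trans_def antisym_def by metis
  qed (use assms in auto)
  then show ?thesis by blast
qed

text \<open>Remove a maximal element, extend the rest by induction, and put the element back on top.
  This makes the denominator in \<open>prob_before\<close> positive.\<close>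

lemma linear_extensions_nonempty:
  assumes "finite V" "partial_order_on V r"
  shows "linear_extensions V r \<noteq> {}"
  using assms
proof (induction V arbitrary: r rule: finite_psubset_induct)
  case (psubset V)
  show ?case
  proof (cases "V = {}")
    case True
    then have "{} \<in> linear_extensions V r"
      using psubset.prems by (auto simp: linear_extensions_def order_on_defs total_on_def refl_on_def)
    then show ?thesis by blast
  next
    case False
    then obtain m where m: "m \<in> V" "\<forall>x\<in>V. (m, x) \<in> r \<longrightarrow> x = m"
      using finite_partial_order_maximal psubset.hyps psubset.prems by blast
    define W where "W = V - {m}"
    have r: "r \<subseteq> V \<times> V" "refl_on V r" "trans r" "antisym r"
      using psubset.prems by (auto simp: order_on_defs)
    have "partial_order_on W (r \<inter> W \<times> W)"
      using r unfolding order_on_defs W_def refl_on_def trans_def antisym_def by blast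
    then have "linear_extensions W (r \<inter> W \<times> W) \<noteq> {}"
      using m by (intro psubset.IH) (auto simp: W_def)
    then obtain L where L: "L \<subseteq> W \<times> W" "refl_on W L" "trans L" "antisym L" "total_on W L"
      "r \<inter> W \<times> W \<subseteq> L"
      by (auto simp: linear_extensions_def order_on_defs)
    \<comment> \<open>The factor is \<open>V\<close> rather than \<open>W\<close>, so that
      \<open>(m, m)\<close> is included and reflexivity holds at \<open>m\<close>.\<close>
    have "L \<union> V \<times> {m} \<in> linear_extensions V r"
      unfolding linear_extensions_def order_on_defs
    proof (intro CollectI conjI)
      show "L \<union> V \<times> {m} \<subseteq> V \<times> V" "refl_on V (L \<union> V \<times> {m})" "total_on V (L \<union> V \<times> {m})"
        using L m(1) by (auto simp: W_def refl_on_def total_on_def)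
      show "trans (L \<union> V \<times> {m})"
        using L(1,3) unfolding W_def trans_def by blast
      show "antisym (L \<union> V \<times> {m})"
        using L(1,4) unfolding W_def antisym_def by blast
      show "r \<subseteq> L \<union> V \<times> {m}"
        using L(6) r(1) m(2) by (auto simp: W_def)
    qed
    then show ?thesis by blast
  qed
qed

lemma finite_linear_extensions:
  assumes "finite V"
  shows "finite (linear_extensions V r)"
proof (rule finite_subset)
  show "linear_extensions V r \<subseteq> Pow (V \<times> V)"
    by (auto simp: linear_extensions_def order_on_defs)
qed (use assms in simp)

lemma linear_extensionsD:
  assumes "L \<in> linear_extensions V r"
  shows "r \<subseteq> L" "refl_on V L" "trans L" "antisym L" "total_on V L"
  using assms by (auto simp: linear_extensions_def order_on_defs)

lemma linear_extensions_converse: "linear_extensions V (r\<inverse>) = converse ` linear_extensions V r"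
proof -
  have conv: "L\<inverse> \<in> linear_extensions V (s\<inverse>)" if "L \<in> linear_extensions V s" for L s
    using that by (auto simp: linear_extensions_def linear_order_on_def)
  show ?thesis
  proof
    show "converse ` linear_extensions V r \<subseteq> linear_extensions V (r\<inverse>)" using conv by blast
    show "linear_extensions V (r\<inverse>) \<subseteq> converse ` linear_extensions V r"
    proof
      fix L assume "L \<in> linear_extensions V (r\<inverse>)"
      then have "L\<inverse> \<in> linear_extensions V r" using conv by fastforce
      then show "L \<in> converse ` linear_extensions V r" by (metis converse_converse imageI)
    qed
  qed
qed

text \<open>Reversal is a bijection between the linear extensions of \<open>r\<close> and those of
  its dual. Hence a balanced pair of the dual, read backwards, is balanced in \<open>r\<close>,
  which settles good pairs of the dual kind.\<close>

lemma prob_before_converse: "prob_before V (r\<inverse>) x y = prob_before V r y x"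
proof -
  have inj: "inj_on converse S" for S :: "'a rel set" by (auto simp: inj_on_def)
  have "{L \<in> linear_extensions V (r\<inverse>). x \<noteq> y \<and> (x, y) \<in> L}
      = converse ` {L \<in> linear_extensions V r. y \<noteq> x \<and> (y, x) \<in> L}"
    by (auto simp: linear_extensions_converse)
  then show ?thesis
    by (simp add: prob_before_def linear_extensions_converse card_image[OF inj])
qed

section \<open>Exchanging two elements of a linear extension\<close>

lemma linear_order_on_inv_image:
  assumes "linear_order_on V L" "bij f" "f ` V = V"
  shows "linear_order_on V (inv_image L f)"
proof -
  have V: "f x \<in> V \<longleftrightarrow> x \<in> V" for x
    using assms(2,3) by (metis bij_is_inj inj_image_mem_iff)
  have "trans (inv_image L f)" "antisym (inv_image L f)"
    using assms(1) bij_is_inj[OF assms(2)]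
    by (auto simp: order_on_defs trans_inv_image antisym_def dest: injD)
  moreover have "inv_image L f \<subseteq> V \<times> V" "refl_on V (inv_image L f)" "total_on V (inv_image L f)"
    using assms(1) V bij_is_inj[OF assms(2)]
    by (auto simp: order_on_defs refl_on_def total_on_def inj_eq)
  ultimately show ?thesis by (simp add: order_on_defs)
qed

text \<open>The exchange moves \<open>a\<close> down to the place of \<open>c\<close> and
  \<open>c\<close> up to the place of \<open>a\<close>. What lies above \<open>a\<close> or below
  \<open>c\<close> is not affected; only elements below \<open>a\<close> and elements above
  \<open>c\<close> could be overtaken. \<open>D\<close> controls the former, \<open>above\<close>
  the latter.\<close>

lemma transpose_linear_extension:
  assumes po: "partial_order_on V r"
    and L: "L \<in> linear_extensions V r"
    and D: "underS r a \<subseteq> underS r b"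
    and "a \<in> V" "c \<in> V" "(b, c) \<in> r" "(c, a) \<in> L"
    and above: "\<And>y. y \<in> aboveS r b - aboveS r a \<Longrightarrow> (c, y) \<in> r \<Longrightarrow> y \<noteq> c \<Longrightarrow> (a, y) \<in> L"
  shows "inv_image L (transpose a c) \<in> linear_extensions V r"
proof -
  note Ld = linear_extensionsD[OF L]
  have r: "r \<subseteq> V \<times> V" "refl_on V r" "trans r" "antisym r"
    using po by (auto simp: order_on_defs)
  have "linear_order_on V (inv_image L (transpose a c))"
    using L assms(4,5) by (intro linear_order_on_inv_image) (auto simp: linear_extensions_def)
  moreover have "r \<subseteq> inv_image L (transpose a c)"
  proof (rule subrelI)
    fix x y assume xy: "(x, y) \<in> r"
    then have xyL: "(x, y) \<in> L" and V: "x \<in> V" "y \<in> V" using Ld(1) r(1) by auto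
    have "(transpose a c x, transpose a c y) \<in> L"
    proof (cases "x = y")
      case True
      then show ?thesis
        using Ld(2) V assms(4,5) by (auto simp: transpose_def refl_on_def)
    next
      case False
      consider "x = a" | "y = a" "x \<noteq> a" | "x = c" "y \<noteq> a" "x \<noteq> a" | "y = c" "x \<noteq> a" "x \<noteq> c"
        | "x \<noteq> a" "x \<noteq> c" "y \<noteq> a" "y \<noteq> c" by blast
      then show ?thesis
      proof cases
        case 1
        then show ?thesis
          using False xyL transD[OF Ld(3) \<open>(c, a) \<in> L\<close>, of y] \<open>(c, a) \<in> L\<close>
          by (auto simp: transpose_def)
      next
        \<comment> \<open>Anything strictly below \<open>a\<close> is strictly below
          \<open>b\<close>, hence strictly below \<open>c\<close>, whose place \<open>a\<close>
          takes.\<close>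
        case 2
        then have "x \<in> underS r b" using D xy by (auto simp: underS_def)
        then have "(x, b) \<in> r" "x \<noteq> b" by (auto simp: underS_def)
        then have "(x, c) \<in> r" "x \<noteq> c"
          using \<open>(b, c) \<in> r\<close> r(3,4) by (meson transD antisymD)+
        then show ?thesis using 2 Ld(1) by (auto simp: transpose_def)
      next
        \<comment> \<open>Here \<open>y\<close> is strictly above \<open>b\<close>. Either it is
          above \<open>a\<close> in \<open>r\<close>, hence in \<open>L\<close>, or
          \<open>above\<close> applies to it.\<close>
        case 3
        have "y \<noteq> b" "(b, y) \<in> r"
          using 3 xy False \<open>(b, c) \<in> r\<close> r(3,4) by (metis transD antisymD)+
        then have "(a, y) \<in> L"
          using above[of y] 3 xy False Ld(1) by (auto simp: aboveS_def)
        then show ?thesis using 3 False by (auto simp: transpose_def)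
      next
        case 4
        then show ?thesis
          using xyL transD[OF Ld(3) _ \<open>(c, a) \<in> L\<close>, of x] by (auto simp: transpose_def)
      next
        case 5
        then show ?thesis using xyL by simp
      qed
    qed
    then show "(x, y) \<in> inv_image L (transpose a c)" by simp
  qed
  ultimately show ?thesis by (simp add: linear_extensions_def)
qed

section \<open>From a good pair to a balanced pair\<close>

lemma good_conditions_imp_balanced:
  assumes fin: "finite V" and po: "partial_order_on V r"
    and "a \<in> V" "b \<in> V" "a \<noteq> b" and good: "good_conditions V r a b"
  shows "\<exists>x y. balanced_pair V r x y"
proof (cases "1/3 \<le> prob_before V r a b")
  case True
  then show ?thesis
    using assms by (intro exI[of _ a] exI[of _ b]) (auto simp: balanced_pair_def good_conditions_def)
next
  case False
  have r: "r \<subseteq> V \<times> V" "refl_on V r" "trans r" "antisym r"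
    using po by (auto simp: order_on_defs)
  let ?E = "linear_extensions V r"
  let ?A = "\<lambda>c. {L \<in> ?E. (a, c) \<in> L}"
  have E: "finite ?E" "0 < card ?E"
    using finite_linear_extensions[OF fin] linear_extensions_nonempty[OF fin po]
    by (auto simp: card_gt_0_iff)
  have D: "underS r a \<subseteq> underS r b" and ch: "aboveS r b - aboveS r a \<in> Chains r"
    using good by (auto simp: good_conditions_def)
  \<comment> \<open>Otherwise \<open>b\<close> would lie strictly below itself. This keeps
    \<open>a\<close> out of \<open>C\<close>, so that \<open>prob\<close> applies to every element
    of \<open>C\<close>.\<close>
  have "(b, a) \<notin> r"
    using D \<open>a \<noteq> b\<close> by (auto simp: underS_def)
  have prob: "prob_before V r a c = card (?A c) / card ?E" if "a \<noteq> c" for c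
    using that by (simp add: prob_before_def)

  define C where "C = insert b (aboveS r b - aboveS r a)"
  have C: "c \<in> V" "(b, c) \<in> r" "c \<noteq> a" if "c \<in> C" for c
    using that r(1,2) \<open>b \<in> V\<close> \<open>a \<noteq> b\<close> \<open>(b, a) \<notin> r\<close>
    by (auto simp: C_def aboveS_def refl_on_def)
  have "finite C" using C(1) fin by (meson finite_subset subsetI)
  have "C \<in> Chains r"
    using ch r(2) \<open>b \<in> V\<close> by (auto simp: C_def Chains_def aboveS_def refl_on_def)
  have sub: "\<exists>m\<in>S. \<forall>x\<in>S. (x, m) \<in> r" "\<exists>m\<in>S. \<forall>x\<in>S. (m, x) \<in> r" if "S \<subseteq> C" "S \<noteq> {}" for S
  proof -
    have "finite S" "S \<in> Chains r"
      using that \<open>finite C\<close> \<open>C \<in> Chains r\<close> by (auto simp: Chains_def intro: finite_subset)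
    then show "\<exists>m\<in>S. \<forall>x\<in>S. (x, m) \<in> r" "\<exists>m\<in>S. \<forall>x\<in>S. (m, x) \<in> r"
      using finite_chain_greatest finite_chain_least that(2) r(3) by blast+
  qed

  have "b \<in> {c \<in> C. prob_before V r a c < 1/3}" using False by (auto simp: C_def)
  then obtain c where c: "c \<in> C" "prob_before V r a c < 1/3"
    and c_max: "\<And>x. x \<in> C \<Longrightarrow> prob_before V r a x < 1/3 \<Longrightarrow> (x, c) \<in> r"
    using sub(1)[of "{c \<in> C. prob_before V r a c < 1/3}"] by blast
  define S where "S = {d \<in> C. (c, d) \<in> r \<and> d \<noteq> c}"
  define B where "B = {L \<in> ?E. (c, a) \<in> L \<and> (\<forall>d\<in>S. (a, d) \<in> L)}"

  have "card B \<le> card (?A c)"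
  proof (rule card_inj_on_le)
    \<comment> \<open>The exchange is its own inverse, hence injective.\<close>
    have "inv_image (inv_image L (transpose a c)) (transpose a c) = L" for L :: "'a rel"
      by (auto simp: inv_image_def)
    then show "inj_on (\<lambda>L. inv_image L (transpose a c)) B" by (rule inj_on_inverseI)
    show "(\<lambda>L. inv_image L (transpose a c)) ` B \<subseteq> ?A c"
    proof (rule image_subsetI)
      fix L assume "L \<in> B"
      then have "L \<in> ?E" "(c, a) \<in> L" "\<forall>d\<in>S. (a, d) \<in> L" by (auto simp: B_def)
      \<comment> \<open>\<open>S\<close> contains every \<open>y\<close> for which the hypothesis
        \<open>above\<close> asks that \<open>a\<close> come before \<open>y\<close>.\<close>
      then have "inv_image L (transpose a c) \<in> ?E"
        using C(1,2)[OF c(1)] by (intro transpose_linear_extension[OF po _ D \<open>a \<in> V\<close>])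
          (auto simp: S_def C_def)
      then show "inv_image L (transpose a c) \<in> ?A c" using \<open>(c, a) \<in> L\<close> by simp
    qed
  qed (use E in simp)
  then have cardU: "card (?A c \<union> B) \<le> 2 * card (?A c)"
    using card_Un_le[of "?A c" B] by linarith
  have finU: "finite (?A c \<union> B)" using E by (simp add: B_def)
  have bound: "real (2 * card (?A c)) < 2/3 * card ?E"
    using c(2) prob[of c] C(3)[OF c(1)] E(2) by (simp add: field_simps)
  have total: "(a, c) \<in> L \<or> (c, a) \<in> L" if "L \<in> ?E" for L
    using linear_extensionsD(5)[OF that] C(1,3)[OF c(1)] \<open>a \<in> V\<close> by (auto simp: total_on_def)

  show ?thesis
  proof (cases "S = {}")
    case True
    then have "?E \<subseteq> ?A c \<union> B" using total by (auto simp: B_def)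
    then have "card ?E \<le> 2 * card (?A c)" using card_mono[OF finU] cardU by (meson le_trans)
    then show ?thesis using bound by linarith
  next
    case False
    then obtain e where e: "e \<in> S" "\<And>x. x \<in> S \<Longrightarrow> (e, x) \<in> r"
      using sub(2)[of S] by (auto simp: S_def)
    then have eC: "e \<in> C" "(c, e) \<in> r" "e \<noteq> c" by (auto simp: S_def)
    \<comment> \<open>As \<open>e\<close> is least in \<open>S\<close>, an extension with
      \<open>a\<close> before \<open>e\<close> has \<open>a\<close> before all of \<open>S\<close>.
      It lies in \<open>?A c\<close> or in \<open>B\<close> according to the order of
      \<open>a\<close> and \<open>c\<close>.\<close>
    have "?A e \<subseteq> ?A c \<union> B"
    proof
      fix L assume L: "L \<in> ?A e"
      then have "(a, d) \<in> L" if "d \<in> S" for d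
        using e(2)[OF that] linear_extensionsD(1,3)[of L V r]
        by (metis (no_types, lifting) mem_Collect_eq subsetD transD)
      then show "L \<in> ?A c \<union> B" using total[of L] L by (auto simp: B_def)
    qed
    then have "card (?A e) \<le> 2 * card (?A c)" using card_mono[OF finU] cardU by (meson le_trans)
    then have "real (card (?A e)) \<le> 2/3 * card ?E" using bound by linarith
    then have "prob_before V r a e \<le> 2/3"
      using prob[OF C(3)[OF eC(1), symmetric]] E(2) by (simp add: divide_le_eq)
    \<comment> \<open>A smaller value would put \<open>e\<close> below \<open>c\<close> by the
      choice of \<open>c\<close>, but \<open>e\<close> is strictly above \<open>c\<close>.\<close>
    moreover have "1/3 \<le> prob_before V r a e"
      using c_max[OF eC(1)] eC(2,3) r(4) by (meson antisymD not_le)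
    ultimately show ?thesis
      using C(1)[OF eC(1)] \<open>a \<in> V\<close> by (auto simp: balanced_pair_def)
  qed
qed

theorem theorem1:
  fixes V :: "'a set" and r :: "'a rel"
  assumes "finite V"
    and "partial_order_on V r"
    and "\<exists>a b. good_pair V r a b"
  shows "\<exists>x y. balanced_pair V r x y"
proof -
  obtain a b where ab: "a \<in> V" "b \<in> V" "a \<noteq> b"
    and "good_conditions V r a b \<or> good_conditions V (r\<inverse>) a b"
    using assms(3) by (auto simp: good_pair_def)
  then show ?thesis
  proof (elim disjE)
    assume "good_conditions V r a b"
    then show ?thesis using good_conditions_imp_balanced[OF assms(1,2) ab] by blast
  next
    assume "good_conditions V (r\<inverse>) a b"
    moreover have "partial_order_on V (r\<inverse>)" using assms(2) by simp
    ultimately obtain x y where "balanced_pair V (r\<inverse>) x y"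
      using good_conditions_imp_balanced[OF assms(1) _ ab] by blast
    then have "balanced_pair V r y x" by (simp add: balanced_pair_def prob_before_converse)
    then show ?thesis by blast
  qed
qed

end
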